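(* Let $\sigma$ be any subsequence (possibly empty) of $e\,w_l\,w_r\,c$. For each of the pairs $(\mathbf{e}\mathcal{FL}_\sigma[\vee,*,0,1],\mathring{\mathbb{M}}^{sl}_\sigma)$, $(\mathbf{e}\mathcal{FL}_\sigma[\vee,\wedge,*,0,1],\mathring{\mathbb{M}}^{\ell}_\sigma)$, $(\mathbf{e}\mathcal{FL}_\sigma[\vee,*,\neg_r,\neg_l,0,1],\mathbb{PM}^{sl}_\sigma)$, $(\mathbf{e}\mathcal{FL}_\sigma[\vee,\wedge,*,\neg_r,\neg_l,0,1],\mathbb{PM}^{\ell}_\sigma)$, writing $(\vdash,\mathbb{K})$ for the pair, the class $\mathbb{K}$ is an algebraic semantics for $\vdash$ with defining equation $1\vee p\approx p$: for every set $\Sigma\cup\{\varphi\}$ of formulas of the corresponding language, $\Sigma\vdash\varphi$ if and only if $\{1\vee\psi\approx\psi:\psi\in\Sigma\}\models_{\mathbb{K}}1\vee\varphi\approx\varphi$.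
   Context: Formulas over a language $\Psi\subseteq\{\vee,\wedge,*,\neg_r,\neg_l,0,1\}$ ($\neg_r$ right negation, $\neg_l$ left negation, unary; $\vee,\wedge,*$ binary; $0,1$ constants) are built from countably many variables. A sequent is $\Gamma\Rightarrow\Delta$ with $\Gamma$ a finite (possibly empty) sequence of formulas and $\Delta$ of length at most one ($\emptyset$ = empty sequence). The calculus has axioms $\varphi\Rightarrow\varphi$, $0\Rightarrow\emptyset$, $\emptyset\Rightarrow1$ and rules ($\Gamma,\Pi,\Sigma$ finite sequences, $\Delta$ of length $\le1$): (Cut) from $\Gamma\Rightarrow\varphi$ and $\Sigma,\varphi,\Pi\Rightarrow\Delta$ infer $\Sigma,\Gamma,\Pi\Rightarrow\Delta$; ($\vee\Rightarrow$) from $\Sigma,\varphi,\Gamma\Rightarrow\Delta$ and $\Sigma,\psi,\Gamma\Rightarrow\Delta$ infer $\Sigma,\varphi\vee\psi,\Gamma\Rightarrow\Delta$; ($\Rightarrow\vee$) from $\Gamma\Rightarrow\varphi$ infer $\Gamma\Rightarrow\varphi\vee\psi$ and $\Gamma\Rightarrow\psi\vee\varphi$; ($\wedge\Rightarrow$) from $\Sigma,\varphi,\Gamma\Rightarrow\Delta$ infer $\Sigma,\varphi\wedge\psi,\Gamma\Rightarrow\Delta$ and $\Sigma,\psi\wedge\varphi,\Gamma\Rightarrow\Delta$; ($\Rightarrow\wedge$) from $\Gamma\Rightarrow\varphi$, $\Gamma\Rightarrow\psi$ infer $\Gamma\Rightarrow\varphi\wedge\psi$; ($*\Rightarrow$)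 from $\Sigma,\varphi,\psi,\Gamma\Rightarrow\Delta$ infer $\Sigma,\varphi*\psi,\Gamma\Rightarrow\Delta$; ($\Rightarrow*$) from $\Gamma\Rightarrow\varphi$, $\Pi\Rightarrow\psi$ infer $\Gamma,\Pi\Rightarrow\varphi*\psi$; ($\neg_r\Rightarrow$) from $\Gamma\Rightarrow\varphi$ infer $\Gamma,\neg_r\varphi\Rightarrow\emptyset$; ($\Rightarrow\neg_r$) from $\varphi,\Gamma\Rightarrow\emptyset$ infer $\Gamma\Rightarrow\neg_r\varphi$; ($\neg_l\Rightarrow$) from $\Gamma\Rightarrow\varphi$ infer $\neg_l\varphi,\Gamma\Rightarrow\emptyset$; ($\Rightarrow\neg_l$) from $\Gamma,\varphi\Rightarrow\emptyset$ infer $\Gamma\Rightarrow\neg_l\varphi$; ($1\Rightarrow$) from $\Sigma,\Gamma\Rightarrow\Delta$ infer $\Sigma,1,\Gamma\Rightarrow\Delta$; ($\Rightarrow0$) from $\Gamma\Rightarrow\emptyset$ infer $\Gamma\Rightarrow0$; plus, for each letter of $\sigma$: $e$: from $\Gamma,\varphi,\psi,\Pi\Rightarrow\Delta$ infer $\Gamma,\psi,\varphi,\Pi\Rightarrow\Delta$; $w_l$: from $\Sigma,\Gamma\Rightarrow\Delta$ infer $\Sigma,\varphi,\Gamma\Rightarrow\Delta$; $w_r$: from $\Gamma\Rightarrow\emptyset$ infer $\Gamma\Rightarrow\varphi$; $c$: from $\Sigma,\varphi,\varphi,\Gamma\Rightarrow\Delta$ infer $\Sigma,\varphi,\Gamma\Rightarrow\Delta$.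 $\mathcal{FL}_\sigma[\Psi]$ uses only $\Psi$-formulas and only the rules for connectives in $\Psi$ (plus structural rules); $\Phi\vdash\varsigma$ iff there is a finite sequence ending in $\varsigma$ each member of which is an axiom instance, in $\Phi$, or obtained from earlier members by a rule instance. The external system $\mathbf{e}\mathcal{FL}_\sigma[\Psi]$ is the Hilbert system with $\Sigma\vdash\varphi$ iff $\{\emptyset\Rightarrow\psi:\psi\in\Sigma\}\vdash_{\mathcal{FL}_\sigma[\Psi]}\emptyset\Rightarrow\varphi$. Algebras ($a\le b$ means $a\vee b=b$): $\mathring{\mathbb{M}}^{sl}_\sigma$ is the class of algebras $\langle A,\vee,*,0,1\rangle$ with $\langle A,\vee\rangle$ a join-semilattice, $\langle A,*,1\rangle$ a monoid, $*$ distributing over $\vee$ on both sides, $0$ arbitrary, and satisfying for each letter of $\sigma$: $e$: $x*y=y*x$; $w_l$: $x\le1$; $w_r$: $0\le x$; $c$: $x\le x*x$. $\mathring{\mathbb{M}}^{\ell}_\sigma$: algebras $\langle A,\vee,\wedge,*,0,1\rangle$ with lattice $\langle\vee,\wedge\rangle$-reduct and $\langle\vee,*,0,1\rangle$-reduct in $\mathring{\mathbb{M}}^{sl}_\sigma$. $\mathbb{PM}^{sl}_\sigma$ (resp. $\mathbb{PM}^{\ell}_\sigma$): algebras $\langle A,\vee,*,\neg_r,\neg_l,0,1\rangle$ (resp. with $\wedge$ too) whose reduct without the negations lies in $\mathring{\mathbb{M}}^{sl}_\sigma$ (resp. $\mathring{\mathbb{M}}^{\ell}_\sigma$) and such that $a*b\le0$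 iff $b\le\neg_r a$ iff $a\le\neg_l b$. $E\models_{\mathbb{K}}\varepsilon$ means every assignment into a member of $\mathbb{K}$ satisfying all equations in $E$ satisfies $\varepsilon$. *)

theory Defs
  imports "HOL-Algebra.Group"
begin

section \<open>Formulas and sequents\<close>

datatype conn = VeeC | WedgeC | FusC | RNegC | LNegC | ZeroC | OneC

datatype fm =
    Var nat
  | Vee fm fm
  | Wedge fm fm
  | Fus fm fm
  | RNeg fm
  | LNeg fm
  | Zero
  | One

primrec conns :: "fm \<Rightarrow> conn set" where
  "conns (Var i) = {}"
| "conns (Vee \<phi> \<psi>) = insert VeeC (conns \<phi> \<union> conns \<psi>)"
| "conns (Wedge \<phi> \<psi>) = insert WedgeC (conns \<phi> \<union> conns \<psi>)"
| "conns (Fus \<phi> \<psi>) = insert FusC (conns \<phi> \<union> conns \<psi>)"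
| "conns (RNeg \<phi>) = insert RNegC (conns \<phi>)"
| "conns (LNeg \<phi>) = insert LNegC (conns \<phi>)"
| "conns Zero = {ZeroC}"
| "conns One = {OneC}"

definition fms :: "conn set \<Rightarrow> fm set" where
  "fms \<Psi> = {\<phi>. conns \<phi> \<subseteq> \<Psi>}"

text \<open>The right-hand side of a sequent has length at most one; \<open>None\<close> is the empty sequence.\<close>

datatype sequent = Seq "fm list" "fm option"  (infix "\<leadsto>" 55)

fun seq_fms :: "sequent \<Rightarrow> fm set" where
  "seq_fms (\<Gamma> \<leadsto> \<Delta>) = set \<Gamma> \<union> set_option \<Delta>"

section \<open>The sequent calculi\<close>

text \<open>Exchange, left weakening, right weakening, contraction. As these letters are distinct and
  always listed in this order, a subsequence of them is the same thing as a set of them.\<close>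

datatype letter = E | WL | WR | C

inductive seq_axiom :: "sequent \<Rightarrow> bool" where
  Id:    "seq_axiom ([\<phi>] \<leadsto> Some \<phi>)"
| ZeroL: "seq_axiom ([Zero] \<leadsto> None)"
| OneR:  "seq_axiom ([] \<leadsto> Some One)"

text \<open>\<open>seq_rule \<sigma> ps s\<close>: the sequent \<open>s\<close> follows from the list of premises \<open>ps\<close> by one instance of
  a rule. Every logical rule has its connective in the conclusion (and so does every axiom
  governing a constant); hence allowing only \<open>\<Psi>\<close>-formulas in derivations, as \<open>derivation\<close> below
  does, also excludes the rules and axioms for connectives outside \<open>\<Psi>\<close>.\<close>

inductive seq_rule :: "letter set \<Rightarrow> sequent list \<Rightarrow> sequent \<Rightarrow> bool" for \<sigma> where
  Cut:    "seq_rule \<sigma> [\<Gamma> \<leadsto> Some \<phi>, \<Sigma> @ [\<phi>] @ \<Lambda> \<leadsto> \<Delta>] (\<Sigma> @ \<Gamma> @ \<Lambda> \<leadsto> \<Delta>)"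
| VeeL:   "seq_rule \<sigma> [\<Sigma> @ [\<phi>] @ \<Gamma> \<leadsto> \<Delta>, \<Sigma> @ [\<psi>] @ \<Gamma> \<leadsto> \<Delta>] (\<Sigma> @ [Vee \<phi> \<psi>] @ \<Gamma> \<leadsto> \<Delta>)"
| VeeR1:  "seq_rule \<sigma> [\<Gamma> \<leadsto> Some \<phi>] (\<Gamma> \<leadsto> Some (Vee \<phi> \<psi>))"
| VeeR2:  "seq_rule \<sigma> [\<Gamma> \<leadsto> Some \<phi>] (\<Gamma> \<leadsto> Some (Vee \<psi> \<phi>))"
| WedgeL1: "seq_rule \<sigma> [\<Sigma> @ [\<phi>] @ \<Gamma> \<leadsto> \<Delta>] (\<Sigma> @ [Wedge \<phi> \<psi>] @ \<Gamma> \<leadsto> \<Delta>)"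
| WedgeL2: "seq_rule \<sigma> [\<Sigma> @ [\<phi>] @ \<Gamma> \<leadsto> \<Delta>] (\<Sigma> @ [Wedge \<psi> \<phi>] @ \<Gamma> \<leadsto> \<Delta>)"
| WedgeR: "seq_rule \<sigma> [\<Gamma> \<leadsto> Some \<phi>, \<Gamma> \<leadsto> Some \<psi>] (\<Gamma> \<leadsto> Some (Wedge \<phi> \<psi>))"
| FusL:   "seq_rule \<sigma> [\<Sigma> @ [\<phi>, \<psi>] @ \<Gamma> \<leadsto> \<Delta>] (\<Sigma> @ [Fus \<phi> \<psi>] @ \<Gamma> \<leadsto> \<Delta>)"
| FusR:   "seq_rule \<sigma> [\<Gamma> \<leadsto> Some \<phi>, \<Lambda> \<leadsto> Some \<psi>] (\<Gamma> @ \<Lambda> \<leadsto> Some (Fus \<phi> \<psi>))"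
| RNegL:  "seq_rule \<sigma> [\<Gamma> \<leadsto> Some \<phi>] (\<Gamma> @ [RNeg \<phi>] \<leadsto> None)"
| RNegR:  "seq_rule \<sigma> [[\<phi>] @ \<Gamma> \<leadsto> None] (\<Gamma> \<leadsto> Some (RNeg \<phi>))"
| LNegL:  "seq_rule \<sigma> [\<Gamma> \<leadsto> Some \<phi>] ([LNeg \<phi>] @ \<Gamma> \<leadsto> None)"
| LNegR:  "seq_rule \<sigma> [\<Gamma> @ [\<phi>] \<leadsto> None] (\<Gamma> \<leadsto> Some (LNeg \<phi>))"
| OneL:   "seq_rule \<sigma> [\<Sigma> @ \<Gamma> \<leadsto> \<Delta>] (\<Sigma> @ [One] @ \<Gamma> \<leadsto> \<Delta>)"
| ZeroR:  "seq_rule \<sigma> [\<Gamma> \<leadsto> None] (\<Gamma> \<leadsto> Some Zero)"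
| Exch:   "E \<in> \<sigma> \<Longrightarrow> seq_rule \<sigma> [\<Gamma> @ [\<phi>, \<psi>] @ \<Lambda> \<leadsto> \<Delta>] (\<Gamma> @ [\<psi>, \<phi>] @ \<Lambda> \<leadsto> \<Delta>)"
| WeakL:  "WL \<in> \<sigma> \<Longrightarrow> seq_rule \<sigma> [\<Sigma> @ \<Gamma> \<leadsto> \<Delta>] (\<Sigma> @ [\<phi>] @ \<Gamma> \<leadsto> \<Delta>)"
| WeakR:  "WR \<in> \<sigma> \<Longrightarrow> seq_rule \<sigma> [\<Gamma> \<leadsto> None] (\<Gamma> \<leadsto> Some \<phi>)"
| Contr:  "C \<in> \<sigma> \<Longrightarrow> seq_rule \<sigma> [\<Sigma> @ [\<phi>, \<phi>] @ \<Gamma> \<leadsto> \<Delta>] (\<Sigma> @ [\<phi>] @ \<Gamma> \<leadsto> \<Delta>)"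

definition derivation ::
    "letter set \<Rightarrow> conn set \<Rightarrow> sequent set \<Rightarrow> sequent list \<Rightarrow> bool" where
  "derivation \<sigma> \<Psi> \<Phi> ds \<longleftrightarrow>
     (\<forall>i < length ds. seq_fms (ds ! i) \<subseteq> fms \<Psi> \<and>
        (seq_axiom (ds ! i) \<or> ds ! i \<in> \<Phi> \<or>
         (\<exists>ps. set ps \<subseteq> set (take i ds) \<and> seq_rule \<sigma> ps (ds ! i))))"

definition FL :: "letter set \<Rightarrow> conn set \<Rightarrow> sequent set \<Rightarrow> sequent \<Rightarrow> bool" where
  "FL \<sigma> \<Psi> \<Phi> s \<longleftrightarrow> (\<exists>ds. ds \<noteq> [] \<and> last ds = s \<and> derivation \<sigma> \<Psi> \<Phi> ds)"

definition eFL :: "letter set \<Rightarrow> conn set \<Rightarrow> fm set \<Rightarrow> fm \<Rightarrow> bool" where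
  "eFL \<sigma> \<Psi> \<Sigma> \<phi> \<longleftrightarrow> FL \<sigma> \<Psi> {[] \<leadsto> Some \<psi> | \<psi>. \<psi> \<in> \<Sigma>} ([] \<leadsto> Some \<phi>)"

section \<open>Algebras\<close>

text \<open>One record serves all four signatures: fields for operations outside the signature of a class
  are left unconstrained in that class, and evaluating formulas of the corresponding language never
  consults them. Accordingly, forming a reduct leaves the record unchanged. The fields
  \<open>mult\<close> and \<open>one\<close> inherited from \<open>monoid\<close> are the fusion and the unit.\<close>

record 'a alg = "'a monoid" +
  vee   :: "'a \<Rightarrow> 'a \<Rightarrow> 'a"
  wedge :: "'a \<Rightarrow> 'a \<Rightarrow> 'a"
  rneg  :: "'a \<Rightarrow> 'a"
  lneg  :: "'a \<Rightarrow> 'a"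
  pt    :: 'a  \<comment> \<open>the constant 0\<close>

definition le :: "'a alg \<Rightarrow> 'a \<Rightarrow> 'a \<Rightarrow> bool" where
  "le A a b \<longleftrightarrow> vee A a b = b"

locale join_semilattice =
  fixes A :: "'a alg"
  assumes vee_closed: "\<lbrakk>x \<in> carrier A; y \<in> carrier A\<rbrakk> \<Longrightarrow> vee A x y \<in> carrier A"
    and vee_assoc: "\<lbrakk>x \<in> carrier A; y \<in> carrier A; z \<in> carrier A\<rbrakk>
      \<Longrightarrow> vee A (vee A x y) z = vee A x (vee A y z)"
    and vee_comm: "\<lbrakk>x \<in> carrier A; y \<in> carrier A\<rbrakk> \<Longrightarrow> vee A x y = vee A y x"
    and vee_idem: "x \<in> carrier A \<Longrightarrow> vee A x x = x"

locale pointed_sl_monoid = join_semilattice A + monoid A for A :: "'a alg" +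
  assumes mult_vee: "\<lbrakk>x \<in> carrier A; y \<in> carrier A; z \<in> carrier A\<rbrakk>
      \<Longrightarrow> x \<otimes>\<^bsub>A\<^esub> vee A y z = vee A (x \<otimes>\<^bsub>A\<^esub> y) (x \<otimes>\<^bsub>A\<^esub> z)"
    and vee_mult: "\<lbrakk>x \<in> carrier A; y \<in> carrier A; z \<in> carrier A\<rbrakk>
      \<Longrightarrow> vee A x y \<otimes>\<^bsub>A\<^esub> z = vee A (x \<otimes>\<^bsub>A\<^esub> z) (y \<otimes>\<^bsub>A\<^esub> z)"
    and pt_closed: "pt A \<in> carrier A"

locale lattice_alg = join_semilattice A for A :: "'a alg" +
  assumes wedge_closed: "\<lbrakk>x \<in> carrier A; y \<in> carrier A\<rbrakk> \<Longrightarrow> wedge A x y \<in> carrier A"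
    and wedge_assoc: "\<lbrakk>x \<in> carrier A; y \<in> carrier A; z \<in> carrier A\<rbrakk>
      \<Longrightarrow> wedge A (wedge A x y) z = wedge A x (wedge A y z)"
    and wedge_comm: "\<lbrakk>x \<in> carrier A; y \<in> carrier A\<rbrakk> \<Longrightarrow> wedge A x y = wedge A y x"
    and wedge_idem: "x \<in> carrier A \<Longrightarrow> wedge A x x = x"
    and vee_wedge_absorb: "\<lbrakk>x \<in> carrier A; y \<in> carrier A\<rbrakk> \<Longrightarrow> vee A x (wedge A x y) = x"
    and wedge_vee_absorb: "\<lbrakk>x \<in> carrier A; y \<in> carrier A\<rbrakk> \<Longrightarrow> wedge A x (vee A x y) = x"

definition structural :: "letter set \<Rightarrow> 'a alg \<Rightarrow> bool" where
  "structural \<sigma> A \<longleftrightarrow>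
     (E \<in> \<sigma> \<longrightarrow> (\<forall>x \<in> carrier A. \<forall>y \<in> carrier A. x \<otimes>\<^bsub>A\<^esub> y = y \<otimes>\<^bsub>A\<^esub> x)) \<and>
     (WL \<in> \<sigma> \<longrightarrow> (\<forall>x \<in> carrier A. le A x \<one>\<^bsub>A\<^esub>)) \<and>
     (WR \<in> \<sigma> \<longrightarrow> (\<forall>x \<in> carrier A. le A (pt A) x)) \<and>
     (C \<in> \<sigma> \<longrightarrow> (\<forall>x \<in> carrier A. le A x (x \<otimes>\<^bsub>A\<^esub> x)))"

definition negations :: "'a alg \<Rightarrow> bool" where
  "negations A \<longleftrightarrow>
     (\<forall>a \<in> carrier A. rneg A a \<in> carrier A \<and> lneg A a \<in> carrier A) \<and>
     (\<forall>a \<in> carrier A. \<forall>b \<in> carrier A.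
        (le A (a \<otimes>\<^bsub>A\<^esub> b) (pt A) \<longleftrightarrow> le A b (rneg A a)) \<and>
        (le A b (rneg A a) \<longleftrightarrow> le A a (lneg A b)))"

definition M_sl :: "letter set \<Rightarrow> 'a alg set" where
  "M_sl \<sigma> = {A. pointed_sl_monoid A \<and> structural \<sigma> A}"

definition M_l :: "letter set \<Rightarrow> 'a alg set" where
  "M_l \<sigma> = {A. lattice_alg A \<and> A \<in> M_sl \<sigma>}"

definition PM_sl :: "letter set \<Rightarrow> 'a alg set" where
  "PM_sl \<sigma> = {A. A \<in> M_sl \<sigma> \<and> negations A}"

definition PM_l :: "letter set \<Rightarrow> 'a alg set" where
  "PM_l \<sigma> = {A. A \<in> M_l \<sigma> \<and> negations A}"

section \<open>Equational consequence and algebraic semantics\<close>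

primrec ev :: "'a alg \<Rightarrow> (nat \<Rightarrow> 'a) \<Rightarrow> fm \<Rightarrow> 'a" where
  "ev A h (Var i) = h i"
| "ev A h (Vee \<phi> \<psi>) = vee A (ev A h \<phi>) (ev A h \<psi>)"
| "ev A h (Wedge \<phi> \<psi>) = wedge A (ev A h \<phi>) (ev A h \<psi>)"
| "ev A h (Fus \<phi> \<psi>) = ev A h \<phi> \<otimes>\<^bsub>A\<^esub> ev A h \<psi>"
| "ev A h (RNeg \<phi>) = rneg A (ev A h \<phi>)"
| "ev A h (LNeg \<phi>) = lneg A (ev A h \<phi>)"
| "ev A h Zero = pt A"
| "ev A h One = \<one>\<^bsub>A\<^esub>"

datatype equation = Eq fm fm  (infix "\<approx>" 55)

fun sat :: "'a alg \<Rightarrow> (nat \<Rightarrow> 'a) \<Rightarrow> equation \<Rightarrow> bool" where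
  "sat A h (s \<approx> t) \<longleftrightarrow> ev A h s = ev A h t"

text \<open>The algebras in \<open>K\<close> have arbitrary subsets of the type \<open>'a\<close> as carriers, so a class over an
  infinite type \<open>'a\<close> contains, up to isomorphism, all its members of cardinality at most that of
  \<open>'a\<close> (finite ones included). Statements about the proper class are obtained by keeping \<open>'a\<close>
  an arbitrary infinite type.\<close>

definition eq_conseq :: "'a alg set \<Rightarrow> equation set \<Rightarrow> equation \<Rightarrow> bool" where
  "eq_conseq K Es \<epsilon> \<longleftrightarrow>
     (\<forall>A \<in> K. \<forall>h. range h \<subseteq> carrier A \<longrightarrow> (\<forall>e \<in> Es. sat A h e) \<longrightarrow> sat A h \<epsilon>)"

text \<open>The parameter \<open>\<tau>\<close> maps a formula \<open>\<psi>\<close> to the instance of the defining equation at \<open>\<psi>\<close>.\<close>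

definition algebraic_semantics ::
    "conn set \<Rightarrow> (fm set \<Rightarrow> fm \<Rightarrow> bool) \<Rightarrow> 'a alg set \<Rightarrow> (fm \<Rightarrow> equation) \<Rightarrow> bool" where
  "algebraic_semantics \<Psi> entails K \<tau> \<longleftrightarrow>
     (\<forall>\<Sigma> \<phi>. \<Sigma> \<subseteq> fms \<Psi> \<longrightarrow> \<phi> \<in> fms \<Psi> \<longrightarrow>
        (entails \<Sigma> \<phi> \<longleftrightarrow> eq_conseq K (\<tau> ` \<Sigma>) (\<tau> \<phi>)))"

end

theory Submission
  imports Defs "HOL-Library.Countable"
begin

text \<open>Soundness: read a sequent as \<open>le\<close> between the product of its left-hand side and its right-hand
  side, with \<open>0\<close> for the empty right-hand side; each rule then preserves validity.
  Completeness: interderivability over the given premises is a congruence on the formulas, and the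
  quotient is an algebra of the class in which \<open>1 \<or> \<phi> = \<phi>\<close> holds exactly for the derivable
  \<open>\<phi>\<close>. There are countably many formulas, so the quotient has a copy inside any infinite type.\<close>

text \<open>The defining equation says 1 \<le> p, and 1 is the empty product: it is the algebraic
  reading of the sequent with empty antecedent and succedent p. An empty succedent may be read as 0
  because it is interderivable with the succedent 0. The left rules for \<open>*\<close> and 1 are
  invertible by cut, so the comma behaves like \<open>*\<close>, and the monoid laws of the quotient
  come down to those of list concatenation. One argument, parametrised by the language
  \<open>\<Psi>\<close>, serves all four pairs: meets and negations are constrained only if their
  connectives lie in \<open>\<Psi>\<close>. The price is that membership in
  \<open>fms \<Psi>\<close> has to be tracked throughout: operations outside the signature may leave
  the carrier, and interderivability is reflexive only on formulas of the language.\<close>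

lemma fms_simps [simp]:
  "Var i \<in> fms \<Psi>"
  "Vee \<phi> \<psi> \<in> fms \<Psi> \<longleftrightarrow> VeeC \<in> \<Psi> \<and> \<phi> \<in> fms \<Psi> \<and> \<psi> \<in> fms \<Psi>"
  "Wedge \<phi> \<psi> \<in> fms \<Psi> \<longleftrightarrow> WedgeC \<in> \<Psi> \<and> \<phi> \<in> fms \<Psi> \<and> \<psi> \<in> fms \<Psi>"
  "Fus \<phi> \<psi> \<in> fms \<Psi> \<longleftrightarrow> FusC \<in> \<Psi> \<and> \<phi> \<in> fms \<Psi> \<and> \<psi> \<in> fms \<Psi>"
  "RNeg \<phi> \<in> fms \<Psi> \<longleftrightarrow> RNegC \<in> \<Psi> \<and> \<phi> \<in> fms \<Psi>"
  "LNeg \<phi> \<in> fms \<Psi> \<longleftrightarrow> LNegC \<in> \<Psi> \<and> \<phi> \<in> fms \<Psi>"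
  "Zero \<in> fms \<Psi> \<longleftrightarrow> ZeroC \<in> \<Psi>"
  "One \<in> fms \<Psi> \<longleftrightarrow> OneC \<in> \<Psi>"
  by (auto simp: fms_def)

section \<open>Derivability\<close>

lemma derivation_append:
  assumes "derivation \<sigma> \<Psi> \<Phi> ds" "derivation \<sigma> \<Psi> \<Phi> es"
  shows "derivation \<sigma> \<Psi> \<Phi> (ds @ es)"
  unfolding derivation_def
proof (intro allI impI)
  fix i assume i: "i < length (ds @ es)"
  show "seq_fms ((ds @ es) ! i) \<subseteq> fms \<Psi> \<and>
    (seq_axiom ((ds @ es) ! i) \<or> (ds @ es) ! i \<in> \<Phi> \<or>
     (\<exists>ps. set ps \<subseteq> set (take i (ds @ es)) \<and> seq_rule \<sigma> ps ((ds @ es) ! i)))"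
  proof (cases "i < length ds")
    case True
    then show ?thesis using assms(1) by (simp add: derivation_def nth_append)
  next
    case False
    then have "i - length ds < length es" using i by simp
    with assms(2) False show ?thesis
      unfolding derivation_def by (auto simp: nth_append) blast
  qed
qed

lemma derivation_snoc:
  assumes "derivation \<sigma> \<Psi> \<Phi> ds" "seq_fms s \<subseteq> fms \<Psi>"
    and "seq_axiom s \<or> s \<in> \<Phi> \<or> (\<exists>ps. set ps \<subseteq> set ds \<and> seq_rule \<sigma> ps s)"
  shows "derivation \<sigma> \<Psi> \<Phi> (ds @ [s])"
  using assms unfolding derivation_def by (auto simp: nth_append less_Suc_eq)

lemma FL_base:
  assumes "seq_axiom s \<or> s \<in> \<Phi>" "seq_fms s \<subseteq> fms \<Psi>"
  shows "FL \<sigma> \<Psi> \<Phi> s"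
  using derivation_snoc[of \<sigma> \<Psi> \<Phi> "[]" s] assms
  unfolding FL_def by (intro exI[of _ "[s]"]) (auto simp: derivation_def)

text \<open>The language restriction binds every entry of a derivation, hence also the last. Later
  lemmas get their side conditions on formulas from the derivability hypotheses in this way.\<close>

lemma FL_wf: "FL \<sigma> \<Psi> \<Phi> s \<Longrightarrow> seq_fms s \<subseteq> fms \<Psi>"
  unfolding FL_def derivation_def by (metis diff_less last_conv_nth length_greater_0_conv zero_less_one)

text \<open>A rule refers only to the set of earlier entries, so derivations of the single premises
  can be concatenated in any order.\<close>

lemma derivation_collect:
  "(\<And>p. p \<in> set ps \<Longrightarrow> FL \<sigma> \<Psi> \<Phi> p) \<Longrightarrow> \<exists>ds. derivation \<sigma> \<Psi> \<Phi> ds \<and> set ps \<subseteq> set ds"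
proof (induction ps)
  case Nil
  show ?case by (intro exI[of _ "[]"]) (simp add: derivation_def)
next
  case (Cons p ps)
  obtain ds where ds: "derivation \<sigma> \<Psi> \<Phi> ds" "set ps \<subseteq> set ds"
    using Cons by auto
  obtain es where es: "es \<noteq> []" "last es = p" "derivation \<sigma> \<Psi> \<Phi> es"
    using Cons.prems[of p] by (auto simp: FL_def)
  have "p \<in> set es" using es by auto
  then show ?case
    using ds derivation_append[OF es(3) ds(1)] by (intro exI[of _ "es @ ds"]) auto
qed

lemma FL_rule:
  assumes "seq_rule \<sigma> ps s" "seq_fms s \<subseteq> fms \<Psi>" "\<forall>p \<in> set ps. FL \<sigma> \<Psi> \<Phi> p"
  shows "FL \<sigma> \<Psi> \<Phi> s"
proof -
  obtain ds where "derivation \<sigma> \<Psi> \<Phi> ds" "set ps \<subseteq> set ds"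
    using derivation_collect[of ps] assms(3) by blast
  then have "derivation \<sigma> \<Psi> \<Phi> (ds @ [s])" using assms by (blast intro: derivation_snoc)
  then show ?thesis unfolding FL_def by (intro exI[of _ "ds @ [s]"]) simp
qed

text \<open>Strong induction on the position in the derivation. The rule case also hands over that
  the premises lie in the language; for cut this does not follow from the conclusion, where the cut
  formula may be missing.\<close>

lemma FL_induct [consumes 1, case_names axiom premise rule]:
  assumes "FL \<sigma> \<Psi> \<Phi> s"
    and ax: "\<And>s. seq_axiom s \<Longrightarrow> seq_fms s \<subseteq> fms \<Psi> \<Longrightarrow> P s"
    and prem: "\<And>s. s \<in> \<Phi> \<Longrightarrow> P s"
    and rule: "\<And>ps s. seq_rule \<sigma> ps s \<Longrightarrow> seq_fms s \<subseteq> fms \<Psi> \<Longrightarrow>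
      (\<And>p. p \<in> set ps \<Longrightarrow> seq_fms p \<subseteq> fms \<Psi>) \<Longrightarrow> (\<And>p. p \<in> set ps \<Longrightarrow> P p) \<Longrightarrow> P s"
  shows "P s"
proof -
  obtain ds where ds: "ds \<noteq> []" "last ds = s" and D: "derivation \<sigma> \<Psi> \<Phi> ds"
    using assms(1) by (auto simp: FL_def)
  have nth: "P (ds ! i)" if "i < length ds" for i
    using that
  proof (induction i rule: less_induct)
    case (less i)
    have wf: "seq_fms (ds ! j) \<subseteq> fms \<Psi>" if "j < length ds" for j
      using D that by (simp add: derivation_def)
    consider "seq_axiom (ds ! i)" | "ds ! i \<in> \<Phi>"
      | ps where "set ps \<subseteq> set (take i ds)" "seq_rule \<sigma> ps (ds ! i)"
      using D less.prems unfolding derivation_def by blast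
    then show ?case
    proof cases
      case 1 then show ?thesis using ax wf less.prems by blast
    next
      case 2 then show ?thesis by (rule prem)
    next
      case 3
      have "\<exists>j < i. p = ds ! j" if "p \<in> set ps" for p
      proof -
        have "p \<in> set (take i ds)" using that 3(1) by blast
        then show ?thesis by (auto simp: in_set_conv_nth)
      qed
      then show ?thesis
        using rule[OF 3(2) wf[OF less.prems]] less wf by (metis less_trans)
    qed
  qed
  have "ds ! (length ds - 1) = s" using ds by (simp add: last_conv_nth)
  then show ?thesis using nth[of "length ds - 1"] ds(1) by auto
qed

section \<open>Soundness\<close>

context join_semilattice
begin

lemma le_refl: "x \<in> carrier A \<Longrightarrow> le A x x"
  by (simp add: le_def vee_idem)

lemma le_trans:
  "\<lbrakk>le A x y; le A y z; x \<in> carrier A; y \<in> carrier A; z \<in> carrier A\<rbrakk> \<Longrightarrow> le A x z"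
  unfolding le_def by (metis vee_assoc)

lemma le_vee1: "\<lbrakk>x \<in> carrier A; y \<in> carrier A\<rbrakk> \<Longrightarrow> le A x (vee A x y)"
  unfolding le_def by (metis vee_assoc vee_idem)

lemma le_vee2: "\<lbrakk>x \<in> carrier A; y \<in> carrier A\<rbrakk> \<Longrightarrow> le A y (vee A x y)"
  using le_vee1 vee_comm by metis

lemma vee_least:
  "\<lbrakk>le A x z; le A y z; x \<in> carrier A; y \<in> carrier A; z \<in> carrier A\<rbrakk> \<Longrightarrow> le A (vee A x y) z"
  unfolding le_def by (metis vee_assoc)

end

context lattice_alg
begin

lemma wedge_le1: "\<lbrakk>x \<in> carrier A; y \<in> carrier A\<rbrakk> \<Longrightarrow> le A (wedge A x y) x"
  unfolding le_def by (metis vee_comm vee_wedge_absorb wedge_closed)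

lemma wedge_le2: "\<lbrakk>x \<in> carrier A; y \<in> carrier A\<rbrakk> \<Longrightarrow> le A (wedge A x y) y"
  using wedge_le1 wedge_comm by metis

text \<open>The order is defined by joins; absorption turns z \<le> x into z \<and> x = z and back,
  after which associativity of meet suffices.\<close>

lemma wedge_greatest:
  "\<lbrakk>le A z x; le A z y; x \<in> carrier A; y \<in> carrier A; z \<in> carrier A\<rbrakk> \<Longrightarrow> le A z (wedge A x y)"
  by (smt (verit, best) le_def vee_wedge_absorb wedge_assoc wedge_closed wedge_comm wedge_vee_absorb vee_comm)

end

context pointed_sl_monoid
begin

lemma mult_left_mono:
  "\<lbrakk>le A x y; x \<in> carrier A; y \<in> carrier A; z \<in> carrier A\<rbrakk> \<Longrightarrow> le A (z \<otimes>\<^bsub>A\<^esub> x) (z \<otimes>\<^bsub>A\<^esub> y)"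
  unfolding le_def by (metis mult_vee)

lemma mult_right_mono:
  "\<lbrakk>le A x y; x \<in> carrier A; y \<in> carrier A; z \<in> carrier A\<rbrakk> \<Longrightarrow> le A (x \<otimes>\<^bsub>A\<^esub> z) (y \<otimes>\<^bsub>A\<^esub> z)"
  unfolding le_def by (metis vee_mult)

lemma mult_mono:
  "\<lbrakk>le A x y; le A u v; x \<in> carrier A; y \<in> carrier A; u \<in> carrier A; v \<in> carrier A\<rbrakk>
    \<Longrightarrow> le A (x \<otimes>\<^bsub>A\<^esub> u) (y \<otimes>\<^bsub>A\<^esub> v)"
  by (rule le_trans[OF mult_right_mono[of x y u] mult_left_mono[of u v y]]) auto

end

text \<open>The fold ends in the unit, so the empty antecedent is worth 1 and no separate case is
  needed for sequents that assert a formula.\<close>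

definition lhs_val :: "'a alg \<Rightarrow> (nat \<Rightarrow> 'a) \<Rightarrow> fm list \<Rightarrow> 'a" where
  "lhs_val A h \<Gamma> = foldr (\<lambda>\<phi> x. ev A h \<phi> \<otimes>\<^bsub>A\<^esub> x) \<Gamma> \<one>\<^bsub>A\<^esub>"

definition rhs_val :: "'a alg \<Rightarrow> (nat \<Rightarrow> 'a) \<Rightarrow> fm option \<Rightarrow> 'a" where
  "rhs_val A h \<Delta> = (case \<Delta> of None \<Rightarrow> pt A | Some \<phi> \<Rightarrow> ev A h \<phi>)"

fun valid :: "'a alg \<Rightarrow> (nat \<Rightarrow> 'a) \<Rightarrow> sequent \<Rightarrow> bool" where
  "valid A h (\<Gamma> \<leadsto> \<Delta>) \<longleftrightarrow> le A (lhs_val A h \<Gamma>) (rhs_val A h \<Delta>)"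

text \<open>Specialises to each of the four classes when \<open>\<Psi>\<close> is the corresponding language.\<close>

definition alg_class :: "letter set \<Rightarrow> conn set \<Rightarrow> 'a alg set" where
  "alg_class \<sigma> \<Psi> = {A \<in> M_sl \<sigma>. (WedgeC \<in> \<Psi> \<longrightarrow> lattice_alg A) \<and>
     (RNegC \<in> \<Psi> \<or> LNegC \<in> \<Psi> \<longrightarrow> negations A)}"

section \<open>Soundness of the rules under one fixed assignment\<close>

locale valuation =
  fixes \<sigma> :: "letter set" and \<Psi> :: "conn set" and A :: "'a alg" and h :: "nat \<Rightarrow> 'a"
  assumes A_class: "A \<in> alg_class \<sigma> \<Psi>" and h_range: "range h \<subseteq> carrier A"
begin

sublocale pointed_sl_monoid A
  using A_class by (simp add: alg_class_def M_sl_def)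

lemma lattice: "WedgeC \<in> \<Psi> \<Longrightarrow> lattice_alg A"
  and negs: "RNegC \<in> \<Psi> \<or> LNegC \<in> \<Psi> \<Longrightarrow> negations A"
  and struct: "structural \<sigma> A"
  using A_class by (auto simp: alg_class_def M_sl_def)

text \<open>Restricted to the language because the fields for other connectives need not preserve
  the carrier.\<close>

lemma ev_closed [simp]: "\<phi> \<in> fms \<Psi> \<Longrightarrow> ev A h \<phi> \<in> carrier A"
proof (induction \<phi>)
  case (Var i) then show ?case using h_range by auto
next
  case (Wedge \<phi> \<psi>) then show ?case using lattice by (simp add: lattice_alg.wedge_closed)
next
  case (RNeg \<phi>) then show ?case using negs by (simp add: negations_def)
next
  case (LNeg \<phi>) then show ?case using negs by (simp add: negations_def)
qed (simp_all add: vee_closed pt_closed)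

lemma lhs_val_Nil [simp]: "lhs_val A h [] = \<one>\<^bsub>A\<^esub>"
  and lhs_val_Cons [simp]: "lhs_val A h (\<phi> # \<Gamma>) = ev A h \<phi> \<otimes>\<^bsub>A\<^esub> lhs_val A h \<Gamma>"
  by (simp_all add: lhs_val_def)

lemma lhs_val_closed [simp]: "set \<Gamma> \<subseteq> fms \<Psi> \<Longrightarrow> lhs_val A h \<Gamma> \<in> carrier A"
  by (induction \<Gamma>) auto

lemma lhs_val_append [simp]:
  "set \<Gamma> \<subseteq> fms \<Psi> \<Longrightarrow> set \<Delta> \<subseteq> fms \<Psi> \<Longrightarrow> lhs_val A h (\<Gamma> @ \<Delta>) = lhs_val A h \<Gamma> \<otimes>\<^bsub>A\<^esub> lhs_val A h \<Delta>"
  by (induction \<Gamma>) (auto simp: m_assoc)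

lemma rhs_val_simps [simp]: "rhs_val A h None = pt A" "rhs_val A h (Some \<phi>) = ev A h \<phi>"
  by (simp_all add: rhs_val_def)

lemma rhs_val_closed [simp]: "set_option \<Delta> \<subseteq> fms \<Psi> \<Longrightarrow> rhs_val A h \<Delta> \<in> carrier A"
  by (cases \<Delta>) (auto simp: pt_closed)

text \<open>The algebraic form of cut: by monotonicity of the product, a factor may be replaced by a
  smaller one. Besides cut it covers the left rules for meet, left weakening and
  contraction.\<close>

lemma replace_part:
  assumes "le A x y" "le A (u \<otimes>\<^bsub>A\<^esub> (y \<otimes>\<^bsub>A\<^esub> v)) z"
    and "x \<in> carrier A" "y \<in> carrier A" "u \<in> carrier A" "v \<in> carrier A" "z \<in> carrier A"
  shows "le A (u \<otimes>\<^bsub>A\<^esub> (x \<otimes>\<^bsub>A\<^esub> v)) z"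
  using assms by (blast intro: le_trans mult_left_mono mult_right_mono m_closed)

lemma rule_sound:
  assumes "seq_rule \<sigma> ps s" "seq_fms s \<subseteq> fms \<Psi>"
    and "\<forall>p \<in> set ps. seq_fms p \<subseteq> fms \<Psi>" "\<forall>p \<in> set ps. valid A h p"
  shows "valid A h s"
  using assms(1)
proof (cases rule: seq_rule.cases)
  case (Cut \<Gamma> \<phi> \<Sigma> \<Lambda> \<Delta>)
  then show ?thesis using assms(2-4) by (auto intro: replace_part)
next
  case (VeeL \<Sigma> \<phi> \<Gamma> \<Delta> \<psi>)
  then show ?thesis using assms(2-4) by (auto simp: vee_mult mult_vee intro: vee_least)
next
  case (VeeR1 \<Gamma> \<phi> \<psi>)
  then show ?thesis using assms(2-4) by (auto intro: le_trans[OF _ le_vee1] simp: vee_closed)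
next
  case (VeeR2 \<Gamma> \<phi> \<psi>)
  then show ?thesis using assms(2-4) by (auto intro: le_trans[OF _ le_vee2] simp: vee_closed)
next
  case (WedgeL1 \<Sigma> \<phi> \<Gamma> \<Delta> \<psi>)
  then interpret L: lattice_alg A using assms(2) lattice by simp
  show ?thesis using WedgeL1 assms(2-4)
    by (auto intro!: replace_part[OF L.wedge_le1] simp: L.wedge_closed)
next
  case (WedgeL2 \<Sigma> \<phi> \<Gamma> \<Delta> \<psi>)
  then interpret L: lattice_alg A using assms(2) lattice by simp
  show ?thesis using WedgeL2 assms(2-4)
    by (auto intro!: replace_part[OF L.wedge_le2] simp: L.wedge_closed)
next
  case (WedgeR \<Gamma> \<phi> \<psi>)
  then interpret L: lattice_alg A using assms(2) lattice by simp
  show ?thesis using WedgeR assms(2-4) by (auto intro: L.wedge_greatest)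
next
  case (FusL \<Sigma> \<phi> \<psi> \<Gamma> \<Delta>)
  then show ?thesis using assms(2-4) by (auto simp: m_assoc)
next
  case (FusR \<Gamma> \<phi> \<Lambda> \<psi>)
  then show ?thesis using assms(2-4) by (auto intro: mult_mono)
next
  case (RNegL \<Gamma> \<phi>)
  then have neg: "negations A" and mem: "set \<Gamma> \<subseteq> fms \<Psi>" "\<phi> \<in> fms \<Psi>"
    using assms(2) negs by auto
  have "le A (lhs_val A h \<Gamma>) (ev A h \<phi>)" using assms(4) RNegL by auto
  moreover have cl: "rneg A (ev A h \<phi>) \<in> carrier A" using neg mem by (auto simp: negations_def)
  \<comment> \<open>Residuation taken at b = \<open>rneg A a\<close>, where the right-hand
    inequality is reflexivity.\<close>
  moreover have "le A (ev A h \<phi> \<otimes>\<^bsub>A\<^esub> rneg A (ev A h \<phi>)) (pt A)"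
    using neg mem cl by (auto simp: negations_def le_refl)
  ultimately have "le A (lhs_val A h \<Gamma> \<otimes>\<^bsub>A\<^esub> rneg A (ev A h \<phi>)) (pt A)"
    using mem by (meson le_trans mult_right_mono m_closed pt_closed ev_closed lhs_val_closed)
  then show ?thesis using RNegL assms(2) mem cl by auto
next
  case (RNegR \<phi> \<Gamma>)
  then show ?thesis using assms(2-4) negs by (auto simp: negations_def)
next
  case (LNegL \<Gamma> \<phi>)
  then have neg: "negations A" and mem: "set \<Gamma> \<subseteq> fms \<Psi>" "\<phi> \<in> fms \<Psi>"
    using assms(2) negs by auto
  have "le A (lhs_val A h \<Gamma>) (ev A h \<phi>)" using assms(4) LNegL by auto
  moreover have cl: "lneg A (ev A h \<phi>) \<in> carrier A" using neg mem by (auto simp: negations_def)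
  moreover have "le A (lneg A (ev A h \<phi>) \<otimes>\<^bsub>A\<^esub> ev A h \<phi>) (pt A)"
    using neg mem cl by (auto simp: negations_def le_refl)
  ultimately have "le A (lneg A (ev A h \<phi>) \<otimes>\<^bsub>A\<^esub> lhs_val A h \<Gamma>) (pt A)"
    using mem by (meson le_trans mult_left_mono m_closed pt_closed ev_closed lhs_val_closed)
  then show ?thesis using LNegL by simp
next
  case (LNegR \<Gamma> \<phi>)
  then show ?thesis using assms(2-4) negs by (auto simp: negations_def)
next
  case (OneL \<Sigma> \<Gamma> \<Delta>)
  then show ?thesis using assms(2-4) by auto
next
  case (ZeroR \<Gamma>)
  then show ?thesis using assms(4) by simp
next
  case (Exch \<Gamma> \<phi> \<psi> \<Lambda> \<Delta>)
  then have mem: "\<phi> \<in> fms \<Psi>" "\<psi> \<in> fms \<Psi>" "set \<Lambda> \<subseteq> fms \<Psi>" using assms(2) by auto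
  then have "ev A h \<phi> \<otimes>\<^bsub>A\<^esub> ev A h \<psi> = ev A h \<psi> \<otimes>\<^bsub>A\<^esub> ev A h \<phi>"
    using Exch struct unfolding structural_def by simp
  \<comment> \<open>The product is nested to the right, so the two exchanged factors must be
    bracketed together, commuted, and separated again.\<close>
  then have "ev A h \<phi> \<otimes>\<^bsub>A\<^esub> (ev A h \<psi> \<otimes>\<^bsub>A\<^esub> lhs_val A h \<Lambda>)
      = ev A h \<psi> \<otimes>\<^bsub>A\<^esub> (ev A h \<phi> \<otimes>\<^bsub>A\<^esub> lhs_val A h \<Lambda>)"
    using mem by (metis m_assoc ev_closed lhs_val_closed)
  then show ?thesis using Exch assms(2-4) by auto
next
  case (WeakL \<Sigma> \<Gamma> \<Delta> \<phi>)
  then have mem: "set \<Sigma> \<subseteq> fms \<Psi>" "set \<Gamma> \<subseteq> fms \<Psi>" "\<phi> \<in> fms \<Psi>" "set_option \<Delta> \<subseteq> fms \<Psi>"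
    using assms(2) by auto
  then have "le A (ev A h \<phi>) \<one>\<^bsub>A\<^esub>" using WeakL struct by (auto simp: structural_def)
  \<comment> \<open>A unit is inserted at the place of the new formula, which can then be replaced
    by the smaller value of \<open>\<phi>\<close>.\<close>
  moreover have "le A (lhs_val A h \<Sigma> \<otimes>\<^bsub>A\<^esub> (\<one>\<^bsub>A\<^esub> \<otimes>\<^bsub>A\<^esub> lhs_val A h \<Gamma>)) (rhs_val A h \<Delta>)"
    using WeakL assms(4) mem by auto
  ultimately show ?thesis using WeakL mem by (auto intro: replace_part)
next
  case (WeakR \<Gamma> \<phi>)
  then have mem: "set \<Gamma> \<subseteq> fms \<Psi>" "\<phi> \<in> fms \<Psi>" using assms(2) by auto
  then have "le A (pt A) (ev A h \<phi>)" using WeakR struct by (auto simp: structural_def)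
  moreover have "le A (lhs_val A h \<Gamma>) (pt A)" using WeakR assms(4) by auto
  ultimately show ?thesis using WeakR mem by (auto intro: le_trans pt_closed)
next
  case (Contr \<Sigma> \<phi> \<Gamma> \<Delta>)
  then have mem: "set \<Sigma> \<subseteq> fms \<Psi>" "set \<Gamma> \<subseteq> fms \<Psi>" "\<phi> \<in> fms \<Psi>" "set_option \<Delta> \<subseteq> fms \<Psi>"
    using assms(2) by auto
  then have "le A (ev A h \<phi>) (ev A h \<phi> \<otimes>\<^bsub>A\<^esub> ev A h \<phi>)"
    using Contr struct by (auto simp: structural_def)
  moreover have "le A (lhs_val A h \<Sigma> \<otimes>\<^bsub>A\<^esub> ((ev A h \<phi> \<otimes>\<^bsub>A\<^esub> ev A h \<phi>) \<otimes>\<^bsub>A\<^esub> lhs_val A h \<Gamma>))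
      (rhs_val A h \<Delta>)"
    using Contr assms(4) mem by (auto simp: m_assoc)
  ultimately show ?thesis using Contr mem by (auto intro: replace_part)
qed

text \<open>Premises need to hold only under this one assignment, which is what makes the result a
  consequence relation between equations.\<close>

lemma FL_sound:
  assumes "FL \<sigma> \<Psi> \<Phi> s" "\<And>s. s \<in> \<Phi> \<Longrightarrow> valid A h s"
  shows "valid A h s"
  using assms(1)
proof (induction rule: FL_induct)
  case (axiom s)
  then show ?case by (cases rule: seq_axiom.cases) (auto simp: le_refl pt_closed)
next
  case (premise s)
  then show ?case by (rule assms(2))
next
  case (rule ps s)
  then show ?case using rule_sound[of ps s] by simp
qed

end

section \<open>The Lindenbaum algebra\<close>

instance fm :: countable
  by countable_datatype

locale calculus =
  fixes \<sigma> :: "letter set" and \<Psi> :: "conn set" and \<Phi> :: "sequent set"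
  assumes lang: "VeeC \<in> \<Psi>" "FusC \<in> \<Psi>" "ZeroC \<in> \<Psi>" "OneC \<in> \<Psi>"
begin

abbreviation pr :: "sequent \<Rightarrow> bool" where "pr \<equiv> FL \<sigma> \<Psi> \<Phi>"

lemma pr_rule: "seq_rule \<sigma> ps s \<Longrightarrow> seq_fms s \<subseteq> fms \<Psi> \<Longrightarrow> \<forall>p \<in> set ps. pr p \<Longrightarrow> pr s"
  by (rule FL_rule)

section \<open>Derivability as a preorder, with the rules recast as universal properties\<close>

definition below :: "fm \<Rightarrow> fm \<Rightarrow> bool" where "below \<phi> \<psi> \<longleftrightarrow> pr ([\<phi>] \<leadsto> Some \<psi>)"

lemma below_fms: "below \<phi> \<psi> \<Longrightarrow> \<phi> \<in> fms \<Psi> \<and> \<psi> \<in> fms \<Psi>"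
  unfolding below_def by (drule FL_wf) simp

lemma below_refl: "\<phi> \<in> fms \<Psi> \<Longrightarrow> below \<phi> \<phi>"
  unfolding below_def by (rule FL_base) (auto intro: seq_axiom.intros)

lemma pr_Cut:
  assumes "pr (\<Gamma> \<leadsto> Some \<phi>)" "pr (\<Sigma> @ [\<phi>] @ \<Lambda> \<leadsto> \<Delta>)"
  shows "pr (\<Sigma> @ \<Gamma> @ \<Lambda> \<leadsto> \<Delta>)"
  using pr_rule[OF Cut[of \<sigma> \<Gamma> \<phi> \<Sigma> \<Lambda> \<Delta>]] assms FL_wf[OF assms(1)] FL_wf[OF assms(2)] by auto

lemma below_trans: "below \<phi> \<psi> \<Longrightarrow> below \<psi> \<chi> \<Longrightarrow> below \<phi> \<chi>"
  unfolding below_def using pr_Cut[of "[\<phi>]" \<psi> "[]" "[]"] by simp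

lemma below_Vee1: "\<phi> \<in> fms \<Psi> \<Longrightarrow> \<psi> \<in> fms \<Psi> \<Longrightarrow> below \<phi> (Vee \<phi> \<psi>)"
  using pr_rule[OF VeeR1[of \<sigma> "[\<phi>]" \<phi> \<psi>]] below_refl lang unfolding below_def by auto

lemma below_Vee2: "\<phi> \<in> fms \<Psi> \<Longrightarrow> \<psi> \<in> fms \<Psi> \<Longrightarrow> below \<psi> (Vee \<phi> \<psi>)"
  using pr_rule[OF VeeR2[of \<sigma> "[\<psi>]" \<psi> \<phi>]] below_refl lang unfolding below_def by auto

lemma pr_VeeL:
  assumes "pr (\<Sigma> @ [\<phi>] @ \<Gamma> \<leadsto> \<Delta>)" "pr (\<Sigma> @ [\<psi>] @ \<Gamma> \<leadsto> \<Delta>)"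
  shows "pr (\<Sigma> @ [Vee \<phi> \<psi>] @ \<Gamma> \<leadsto> \<Delta>)"
  using pr_rule[OF VeeL[of \<sigma> \<Sigma> \<phi> \<Gamma> \<Delta> \<psi>]] assms FL_wf[OF assms(1)] FL_wf[OF assms(2)] lang by auto

lemma Vee_below: "below \<phi> \<chi> \<Longrightarrow> below \<psi> \<chi> \<Longrightarrow> below (Vee \<phi> \<psi>) \<chi>"
  unfolding below_def using pr_VeeL[of "[]" \<phi> "[]"] by simp

text \<open>Together with \<open>equiI\<close>, this universal property reduces the semilattice laws
  to propositional logic; \<open>below_Wedge_iff\<close> and \<open>equiI'\<close> do the same for
  meet.\<close>

lemma Vee_below_iff: "\<phi> \<in> fms \<Psi> \<Longrightarrow> \<psi> \<in> fms \<Psi> \<Longrightarrow> below (Vee \<phi> \<psi>) \<chi> \<longleftrightarrow> below \<phi> \<chi> \<and> below \<psi> \<chi>"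
  by (meson Vee_below below_Vee1 below_Vee2 below_trans)

lemma Wedge_below1:
  assumes "WedgeC \<in> \<Psi>" "\<phi> \<in> fms \<Psi>" "\<psi> \<in> fms \<Psi>"
  shows "below (Wedge \<phi> \<psi>) \<phi>"
  using pr_rule[OF WedgeL1[of \<sigma> "[]" \<phi> "[]" "Some \<phi>" \<psi>]] below_refl assms unfolding below_def by auto

lemma Wedge_below2:
  assumes "WedgeC \<in> \<Psi>" "\<phi> \<in> fms \<Psi>" "\<psi> \<in> fms \<Psi>"
  shows "below (Wedge \<phi> \<psi>) \<psi>"
  using pr_rule[OF WedgeL2[of \<sigma> "[]" \<psi> "[]" "Some \<psi>" \<phi>]] below_refl assms unfolding below_def by auto

lemma below_Wedge:
  assumes "WedgeC \<in> \<Psi>" "below \<chi> \<phi>" "below \<chi> \<psi>"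
  shows "below \<chi> (Wedge \<phi> \<psi>)"
  using pr_rule[OF WedgeR[of \<sigma> "[\<chi>]" \<phi> \<psi>]] assms below_fms[OF assms(2)] below_fms[OF assms(3)]
  unfolding below_def by auto

lemma below_Wedge_iff:
  "WedgeC \<in> \<Psi> \<Longrightarrow> \<phi> \<in> fms \<Psi> \<Longrightarrow> \<psi> \<in> fms \<Psi> \<Longrightarrow> below \<chi> (Wedge \<phi> \<psi>) \<longleftrightarrow> below \<chi> \<phi> \<and> below \<chi> \<psi>"
  by (meson below_Wedge Wedge_below1 Wedge_below2 below_trans)

lemma Wedge_below_mono:
  assumes "WedgeC \<in> \<Psi>" "below \<phi> \<phi>'" "below \<psi> \<psi>'"
  shows "below (Wedge \<phi> \<psi>) (Wedge \<phi>' \<psi>')"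
proof -
  have "\<phi> \<in> fms \<Psi>" "\<psi> \<in> fms \<Psi>" using assms below_fms by auto
  then show ?thesis
    using assms Wedge_below1[of \<phi> \<psi>] Wedge_below2[of \<phi> \<psi>] by (blast intro: below_Wedge below_trans)
qed

lemma pr_FusR:
  assumes "pr (\<Gamma> \<leadsto> Some \<phi>)" "pr (\<Lambda> \<leadsto> Some \<psi>)"
  shows "pr (\<Gamma> @ \<Lambda> \<leadsto> Some (Fus \<phi> \<psi>))"
  using pr_rule[OF FusR[of \<sigma> \<Gamma> \<phi> \<Lambda> \<psi>]] assms FL_wf[OF assms(1)] FL_wf[OF assms(2)] lang by auto

text \<open>Cutting with \<phi>, \<psi> \<Rightarrow> \<phi> * \<psi> inverts the left rule, so
  fusion and comma are interchangeable in every context.\<close>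

lemma pr_Fus_iff:
  assumes "\<phi> \<in> fms \<Psi>" "\<psi> \<in> fms \<Psi>"
  shows "pr (\<Sigma> @ [Fus \<phi> \<psi>] @ \<Gamma> \<leadsto> \<Delta>) \<longleftrightarrow> pr (\<Sigma> @ [\<phi>, \<psi>] @ \<Gamma> \<leadsto> \<Delta>)"
proof
  assume "pr (\<Sigma> @ [\<phi>, \<psi>] @ \<Gamma> \<leadsto> \<Delta>)"
  from FL_wf[OF this] this show "pr (\<Sigma> @ [Fus \<phi> \<psi>] @ \<Gamma> \<leadsto> \<Delta>)"
    using pr_rule[OF FusL[of \<sigma> \<Sigma> \<phi> \<psi> \<Gamma> \<Delta>]] lang by auto
next
  assume "pr (\<Sigma> @ [Fus \<phi> \<psi>] @ \<Gamma> \<leadsto> \<Delta>)"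
  moreover have "pr ([\<phi>, \<psi>] \<leadsto> Some (Fus \<phi> \<psi>))"
    using pr_FusR[of "[\<phi>]" \<phi> "[\<psi>]" \<psi>] assms below_refl by (simp add: below_def)
  ultimately show "pr (\<Sigma> @ [\<phi>, \<psi>] @ \<Gamma> \<leadsto> \<Delta>)" using pr_Cut by blast
qed

lemma Fus_below_iff:
  "\<phi> \<in> fms \<Psi> \<Longrightarrow> \<psi> \<in> fms \<Psi> \<Longrightarrow> below (Fus \<phi> \<psi>) \<chi> \<longleftrightarrow> pr ([\<phi>, \<psi>] \<leadsto> Some \<chi>)"
  unfolding below_def using pr_Fus_iff[of \<phi> \<psi> "[]" "[]"] by simp

lemma Fus_below_mono:
  assumes "below \<phi> \<phi>'" "below \<psi> \<psi>'"
  shows "below (Fus \<phi> \<psi>) (Fus \<phi>' \<psi>')"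
  using assms below_fms pr_FusR[of "[\<phi>]" \<phi>' "[\<psi>]" \<psi>'] Fus_below_iff
  by (simp add: below_def)

lemma pr_One_iff:
  assumes "set \<Sigma> \<subseteq> fms \<Psi>" "set \<Gamma> \<subseteq> fms \<Psi>"
  shows "pr (\<Sigma> @ [One] @ \<Gamma> \<leadsto> \<Delta>) \<longleftrightarrow> pr (\<Sigma> @ \<Gamma> \<leadsto> \<Delta>)"
proof
  assume "pr (\<Sigma> @ \<Gamma> \<leadsto> \<Delta>)"
  from FL_wf[OF this] this show "pr (\<Sigma> @ [One] @ \<Gamma> \<leadsto> \<Delta>)"
    using pr_rule[OF OneL[of \<sigma> \<Sigma> \<Gamma> \<Delta>]] lang by auto
next
  have "pr ([] \<leadsto> Some One)"
    by (rule FL_base) (auto intro: seq_axiom.intros simp: lang)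
  moreover assume "pr (\<Sigma> @ [One] @ \<Gamma> \<leadsto> \<Delta>)"
  ultimately show "pr (\<Sigma> @ \<Gamma> \<leadsto> \<Delta>)" using pr_Cut[of "[]"] by fastforce
qed

lemma One_below_iff: "below One \<phi> \<longleftrightarrow> pr ([] \<leadsto> Some \<phi>)"
  unfolding below_def using pr_One_iff[of "[]" "[]"] by simp

text \<open>The axiom for 0 inverts the right rule by cut. This translates the empty succedents of
  the negation rules into the inequalities \<le> 0 of the algebras.\<close>

lemma pr_Zero_iff: "pr (\<Gamma> \<leadsto> Some Zero) \<longleftrightarrow> pr (\<Gamma> \<leadsto> None)"
proof
  assume "pr (\<Gamma> \<leadsto> None)"
  from FL_wf[OF this] this show "pr (\<Gamma> \<leadsto> Some Zero)"
    using pr_rule[OF ZeroR[of \<sigma> \<Gamma>]] lang by auto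
next
  have "pr ([Zero] \<leadsto> None)"
    by (rule FL_base) (auto intro: seq_axiom.intros simp: lang)
  moreover assume "pr (\<Gamma> \<leadsto> Some Zero)"
  ultimately show "pr (\<Gamma> \<leadsto> None)" using pr_Cut[of \<Gamma> Zero "[]" "[]"] by simp
qed

lemma Fus_below_Zero_iff:
  "\<phi> \<in> fms \<Psi> \<Longrightarrow> \<psi> \<in> fms \<Psi> \<Longrightarrow> below (Fus \<phi> \<psi>) Zero \<longleftrightarrow> pr ([\<phi>, \<psi>] \<leadsto> None)"
  by (simp add: Fus_below_iff pr_Zero_iff)

lemma below_RNeg_iff:
  assumes "RNegC \<in> \<Psi>" "\<phi> \<in> fms \<Psi>" "\<psi> \<in> fms \<Psi>"
  shows "below \<psi> (RNeg \<phi>) \<longleftrightarrow> below (Fus \<phi> \<psi>) Zero"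
proof
  assume "below (Fus \<phi> \<psi>) Zero"
  then have "pr ([\<phi>, \<psi>] \<leadsto> None)" using assms by (simp add: Fus_below_Zero_iff)
  then show "below \<psi> (RNeg \<phi>)"
    using pr_rule[OF RNegR[of \<sigma> \<phi> "[\<psi>]"]] assms by (auto simp: below_def)
next
  assume *: "below \<psi> (RNeg \<phi>)"
  have "pr ([\<phi>, RNeg \<phi>] \<leadsto> None)"
    using pr_rule[OF RNegL[of \<sigma> "[\<phi>]" \<phi>]] assms below_refl by (auto simp: below_def)
  then have "pr ([\<phi>, \<psi>] \<leadsto> None)"
    using pr_Cut[of "[\<psi>]" "RNeg \<phi>" "[\<phi>]" "[]"] * by (simp add: below_def)
  then show "below (Fus \<phi> \<psi>) Zero" using assms by (simp add: Fus_below_Zero_iff)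
qed

lemma below_LNeg_iff:
  assumes "LNegC \<in> \<Psi>" "\<phi> \<in> fms \<Psi>" "\<psi> \<in> fms \<Psi>"
  shows "below \<phi> (LNeg \<psi>) \<longleftrightarrow> below (Fus \<phi> \<psi>) Zero"
proof
  assume "below (Fus \<phi> \<psi>) Zero"
  then have "pr ([\<phi>, \<psi>] \<leadsto> None)" using assms by (simp add: Fus_below_Zero_iff)
  then show "below \<phi> (LNeg \<psi>)"
    using pr_rule[OF LNegR[of \<sigma> "[\<phi>]" \<psi>]] assms by (auto simp: below_def)
next
  assume *: "below \<phi> (LNeg \<psi>)"
  have "pr ([LNeg \<psi>, \<psi>] \<leadsto> None)"
    using pr_rule[OF LNegL[of \<sigma> "[\<psi>]" \<psi>]] assms below_refl by (auto simp: below_def)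
  then have "pr ([\<phi>, \<psi>] \<leadsto> None)"
    using pr_Cut[of "[\<phi>]" "LNeg \<psi>" "[]" "[\<psi>]"] * by (simp add: below_def)
  then show "below (Fus \<phi> \<psi>) Zero" using assms by (simp add: Fus_below_Zero_iff)
qed

text \<open>Antitonicity follows from residuation: \<psi> times its right negation is below 0, and
  replacing \<psi> by the smaller \<phi> keeps the product below 0.\<close>

lemma below_RNeg_mono:
  assumes "RNegC \<in> \<Psi>" "below \<phi> \<psi>"
  shows "below (RNeg \<psi>) (RNeg \<phi>)"
proof -
  have mem: "\<phi> \<in> fms \<Psi>" "\<psi> \<in> fms \<Psi>" "RNeg \<psi> \<in> fms \<Psi>"
    using assms below_fms by auto
  then have "below (Fus \<psi> (RNeg \<psi>)) Zero" using assms(1) below_RNeg_iff below_refl by blast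
  then have "below (Fus \<phi> (RNeg \<psi>)) Zero"
    using below_trans Fus_below_mono assms(2) below_refl mem(3) by blast
  then show ?thesis using below_RNeg_iff assms(1) mem by blast
qed

lemma below_LNeg_mono:
  assumes "LNegC \<in> \<Psi>" "below \<phi> \<psi>"
  shows "below (LNeg \<psi>) (LNeg \<phi>)"
proof -
  have mem: "\<phi> \<in> fms \<Psi>" "\<psi> \<in> fms \<Psi>" "LNeg \<psi> \<in> fms \<Psi>"
    using assms below_fms by auto
  then have "below (Fus (LNeg \<psi>) \<psi>) Zero" using assms(1) below_LNeg_iff below_refl by blast
  then have "below (Fus (LNeg \<psi>) \<phi>) Zero"
    using below_trans Fus_below_mono assms(2) below_refl mem(3) by blast
  then show ?thesis using below_LNeg_iff assms(1) mem by blast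
qed

section \<open>Interderivability as a congruence satisfying the laws of the class\<close>

definition equi :: "fm \<Rightarrow> fm \<Rightarrow> bool" where "equi \<phi> \<psi> \<longleftrightarrow> below \<phi> \<psi> \<and> below \<psi> \<phi>"

text \<open>Testing the equivalence at \<phi> and at \<psi> themselves gives both
  inequalities.\<close>

lemma equiI:
  assumes "\<phi> \<in> fms \<Psi>" "\<psi> \<in> fms \<Psi>" "\<And>\<chi>. \<chi> \<in> fms \<Psi> \<Longrightarrow> below \<phi> \<chi> \<longleftrightarrow> below \<psi> \<chi>"
  shows "equi \<phi> \<psi>"
  using assms below_refl unfolding equi_def by blast

lemma equiI':
  assumes "\<phi> \<in> fms \<Psi>" "\<psi> \<in> fms \<Psi>" "\<And>\<chi>. \<chi> \<in> fms \<Psi> \<Longrightarrow> below \<chi> \<phi> \<longleftrightarrow> below \<chi> \<psi>"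
  shows "equi \<phi> \<psi>"
  using assms below_refl unfolding equi_def by blast

text \<open>Both bracketings are below \<theta> exactly when the sequent \<phi>, \<psi>, \<chi>
  \<Rightarrow> \<theta> is derivable.\<close>

lemma Fus_assoc:
  assumes "\<phi> \<in> fms \<Psi>" "\<psi> \<in> fms \<Psi>" "\<chi> \<in> fms \<Psi>"
  shows "equi (Fus (Fus \<phi> \<psi>) \<chi>) (Fus \<phi> (Fus \<psi> \<chi>))"
  using assms lang pr_Fus_iff[of \<phi> \<psi> "[]" "[\<chi>]"] pr_Fus_iff[of \<psi> \<chi> "[\<phi>]" "[]"]
  by (intro equiI) (auto simp: Fus_below_iff)

lemma One_Fus: "\<phi> \<in> fms \<Psi> \<Longrightarrow> equi (Fus One \<phi>) \<phi>"
  using lang pr_One_iff[of "[]" "[\<phi>]"] Fus_below_iff[of One \<phi>]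
  by (intro equiI) (simp_all add: below_def)

lemma Fus_One: "\<phi> \<in> fms \<Psi> \<Longrightarrow> equi (Fus \<phi> One) \<phi>"
  using lang pr_One_iff[of "[\<phi>]" "[]"] Fus_below_iff[of \<phi> One]
  by (intro equiI) (simp_all add: below_def)

text \<open>One half is the left rule for \<or> with \<phi> as left context, the other is
  monotonicity of fusion.\<close>

lemma Fus_Vee:
  assumes "\<phi> \<in> fms \<Psi>" "\<psi> \<in> fms \<Psi>" "\<chi> \<in> fms \<Psi>"
  shows "equi (Fus \<phi> (Vee \<psi> \<chi>)) (Vee (Fus \<phi> \<psi>) (Fus \<phi> \<chi>))"
proof -
  have "below (Fus \<phi> (Vee \<psi> \<chi>)) \<theta>" if "below (Fus \<phi> \<psi>) \<theta>" "below (Fus \<phi> \<chi>) \<theta>" for \<theta>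
    using that assms lang pr_VeeL[of "[\<phi>]" \<psi> "[]" "Some \<theta>" \<chi>] by (simp add: Fus_below_iff)
  moreover have "below (Fus \<phi> \<psi>) (Fus \<phi> (Vee \<psi> \<chi>))" "below (Fus \<phi> \<chi>) (Fus \<phi> (Vee \<psi> \<chi>))"
    using assms by (auto intro!: Fus_below_mono below_refl below_Vee1 below_Vee2)
  ultimately show ?thesis
    using assms lang by (intro equiI) (auto simp: Vee_below_iff intro: below_trans)
qed

lemma Vee_Fus:
  assumes "\<phi> \<in> fms \<Psi>" "\<psi> \<in> fms \<Psi>" "\<chi> \<in> fms \<Psi>"
  shows "equi (Fus (Vee \<phi> \<psi>) \<chi>) (Vee (Fus \<phi> \<chi>) (Fus \<psi> \<chi>))"
proof -
  have "below (Fus (Vee \<phi> \<psi>) \<chi>) \<theta>" if "below (Fus \<phi> \<chi>) \<theta>" "below (Fus \<psi> \<chi>) \<theta>" for \<theta>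
    using that assms lang pr_VeeL[of "[]" \<phi> "[\<chi>]" "Some \<theta>" \<psi>] by (simp add: Fus_below_iff)
  moreover have "below (Fus \<phi> \<chi>) (Fus (Vee \<phi> \<psi>) \<chi>)" "below (Fus \<psi> \<chi>) (Fus (Vee \<phi> \<psi>) \<chi>)"
    using assms by (auto intro!: Fus_below_mono below_refl below_Vee1 below_Vee2)
  ultimately show ?thesis
    using assms lang by (intro equiI) (auto simp: Vee_below_iff intro: below_trans)
qed

lemma Fus_comm:
  assumes "E \<in> \<sigma>" "\<phi> \<in> fms \<Psi>" "\<psi> \<in> fms \<Psi>"
  shows "equi (Fus \<phi> \<psi>) (Fus \<psi> \<phi>)"
proof -
  have "pr ([\<psi>', \<phi>'] \<leadsto> Some \<chi>)" if "pr ([\<phi>', \<psi>'] \<leadsto> Some \<chi>)" for \<phi>' \<psi>' \<chi>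
    using pr_rule[OF Exch[OF assms(1), of "[]" \<phi>' \<psi>' "[]" "Some \<chi>"]] FL_wf[OF that] that by auto
  then show ?thesis using assms lang by (intro equiI) (auto simp: Fus_below_iff)
qed

lemma below_One:
  assumes "WL \<in> \<sigma>" "\<phi> \<in> fms \<Psi>"
  shows "below \<phi> One"
  using pr_rule[OF WeakL[OF assms(1), of "[]" "[]" "Some One" \<phi>]] assms lang
    One_below_iff[of One] below_refl[of One] by (auto simp: below_def)

lemma Zero_below:
  assumes "WR \<in> \<sigma>" "\<phi> \<in> fms \<Psi>"
  shows "below Zero \<phi>"
  using pr_rule[OF WeakR[OF assms(1), of "[Zero]" \<phi>]] assms lang
    pr_Zero_iff[of "[Zero]"] below_refl[of Zero] by (auto simp: below_def)

lemma below_Fus_self: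
  assumes "C \<in> \<sigma>" "\<phi> \<in> fms \<Psi>"
  shows "below \<phi> (Fus \<phi> \<phi>)"
  using pr_rule[OF Contr[OF assms(1), of "[]" \<phi> "[]" "Some (Fus \<phi> \<phi>)"]] assms lang
    Fus_below_iff[of \<phi> \<phi> "Fus \<phi> \<phi>"] below_refl[of "Fus \<phi> \<phi>"] by (auto simp: below_def)

lemma equi_refl: "\<phi> \<in> fms \<Psi> \<Longrightarrow> equi \<phi> \<phi>"
  and equi_sym: "equi \<phi> \<psi> \<Longrightarrow> equi \<psi> \<phi>"
  and equi_trans: "equi \<phi> \<psi> \<Longrightarrow> equi \<psi> \<chi> \<Longrightarrow> equi \<phi> \<chi>"
  unfolding equi_def using below_refl below_trans by blast+

lemma equi_Vee:
  assumes "equi \<phi> \<phi>'" "equi \<psi> \<psi>'"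
  shows "equi (Vee \<phi> \<psi>) (Vee \<phi>' \<psi>')"
  using assms unfolding equi_def by (meson Vee_below_iff below_fms below_Vee1 below_Vee2 below_trans)

lemma equi_Fus: "equi \<phi> \<phi>' \<Longrightarrow> equi \<psi> \<psi>' \<Longrightarrow> equi (Fus \<phi> \<psi>) (Fus \<phi>' \<psi>')"
  unfolding equi_def using Fus_below_mono by blast

lemma equi_Wedge:
  assumes "WedgeC \<in> \<Psi>" "equi \<phi> \<phi>'" "equi \<psi> \<psi>'"
  shows "equi (Wedge \<phi> \<psi>) (Wedge \<phi>' \<psi>')"
  using assms Wedge_below_mono unfolding equi_def by blast

lemma equi_RNeg: "RNegC \<in> \<Psi> \<Longrightarrow> equi \<phi> \<psi> \<Longrightarrow> equi (RNeg \<phi>) (RNeg \<psi>)"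
  and equi_LNeg: "LNegC \<in> \<Psi> \<Longrightarrow> equi \<phi> \<psi> \<Longrightarrow> equi (LNeg \<phi>) (LNeg \<psi>)"
  unfolding equi_def using below_RNeg_mono below_LNeg_mono by blast+

text \<open>Equivalence classes are not elements of \<open>'a\<close>, so each class is sent to the
  code of a chosen member, a natural number, which is then injected into the infinite type.\<close>

lemma quotient_map:
  assumes "infinite (UNIV :: 'a set)"
  obtains q :: "fm \<Rightarrow> 'a"
  where "\<And>\<phi> \<psi>. \<phi> \<in> fms \<Psi> \<Longrightarrow> \<psi> \<in> fms \<Psi> \<Longrightarrow> q \<phi> = q \<psi> \<longleftrightarrow> equi \<phi> \<psi>"
proof -
  obtain f :: "nat \<Rightarrow> 'a" where "inj f"
    using assms infinite_countable_subset by blast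
  define r where "r \<phi> = (SOME \<chi>. equi \<phi> \<chi>)" for \<phi>
  have r: "equi \<phi> (r \<phi>)" if "\<phi> \<in> fms \<Psi>" for \<phi>
    unfolding r_def by (rule someI) (rule equi_refl[OF that])
  have "r \<phi> = r \<psi> \<longleftrightarrow> equi \<phi> \<psi>" if "\<phi> \<in> fms \<Psi>" "\<psi> \<in> fms \<Psi>" for \<phi> \<psi>
  proof
    assume "r \<phi> = r \<psi>"
    then show "equi \<phi> \<psi>" using r[OF that(1)] r[OF that(2)] equi_sym equi_trans by metis
  next
    assume "equi \<phi> \<psi>"
    \<comment> \<open>Equal predicates have equal choices, so \<open>r\<close> is constant on
      classes.\<close>
    then have "equi \<phi> = equi \<psi>" using equi_sym equi_trans by blast
    then show "r \<phi> = r \<psi>" by (simp add: r_def)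
  qed
  then show thesis
    using \<open>inj f\<close> by (intro that[of "\<lambda>\<phi>. f (to_nat (r \<phi>))"]) (simp add: inj_eq)
qed

end

section \<open>The quotient algebra and its canonical assignment\<close>

locale lindenbaum = calculus +
  fixes q :: "fm \<Rightarrow> 'a"
  assumes q_eq: "\<lbrakk>\<phi> \<in> fms \<Psi>; \<psi> \<in> fms \<Psi>\<rbrakk> \<Longrightarrow> q \<phi> = q \<psi> \<longleftrightarrow> equi \<phi> \<psi>"
    and neg_lang: "RNegC \<in> \<Psi> \<longleftrightarrow> LNegC \<in> \<Psi>"
begin

text \<open>The choice is confined to the language because nothing is assumed about \<open>q\<close>
  outside it.\<close>

definition rep :: "'a \<Rightarrow> fm" where "rep a = (SOME \<phi>. \<phi> \<in> fms \<Psi> \<and> q \<phi> = a)"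

text \<open>Operations act on representatives; that they descend to classes is the content of
  \<open>mult_L\<close> to \<open>lneg_L\<close>. The fields for connectives outside the language
  hold arbitrary values, as the class permits.\<close>

definition L :: "'a alg" where
  "L = \<lparr>carrier = q ` fms \<Psi>, mult = \<lambda>a b. q (Fus (rep a) (rep b)), one = q One,
        vee = \<lambda>a b. q (Vee (rep a) (rep b)), wedge = \<lambda>a b. q (Wedge (rep a) (rep b)),
        rneg = \<lambda>a. q (RNeg (rep a)), lneg = \<lambda>a. q (LNeg (rep a)), pt = q Zero\<rparr>"

lemma rep_q: "\<phi> \<in> fms \<Psi> \<Longrightarrow> rep (q \<phi>) \<in> fms \<Psi> \<and> equi (rep (q \<phi>)) \<phi>"
  unfolding rep_def using someI_ex[of "\<lambda>\<psi>. \<psi> \<in> fms \<Psi> \<and> q \<psi> = q \<phi>"] q_eq by blast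

lemma carrier_L [simp]: "carrier L = q ` fms \<Psi>"
  and one_L [simp]: "\<one>\<^bsub>L\<^esub> = q One"
  and pt_L [simp]: "pt L = q Zero"
  by (simp_all add: L_def)

lemma mult_L [simp]: "\<phi> \<in> fms \<Psi> \<Longrightarrow> \<psi> \<in> fms \<Psi> \<Longrightarrow> q \<phi> \<otimes>\<^bsub>L\<^esub> q \<psi> = q (Fus \<phi> \<psi>)"
  using rep_q[of \<phi>] rep_q[of \<psi>] lang by (simp add: L_def q_eq equi_Fus)

lemma vee_L [simp]: "\<phi> \<in> fms \<Psi> \<Longrightarrow> \<psi> \<in> fms \<Psi> \<Longrightarrow> vee L (q \<phi>) (q \<psi>) = q (Vee \<phi> \<psi>)"
  using rep_q[of \<phi>] rep_q[of \<psi>] lang by (simp add: L_def q_eq equi_Vee)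

lemma wedge_L [simp]:
  "WedgeC \<in> \<Psi> \<Longrightarrow> \<phi> \<in> fms \<Psi> \<Longrightarrow> \<psi> \<in> fms \<Psi> \<Longrightarrow> wedge L (q \<phi>) (q \<psi>) = q (Wedge \<phi> \<psi>)"
  using rep_q[of \<phi>] rep_q[of \<psi>] by (simp add: L_def q_eq equi_Wedge)

lemma rneg_L [simp]: "RNegC \<in> \<Psi> \<Longrightarrow> \<phi> \<in> fms \<Psi> \<Longrightarrow> rneg L (q \<phi>) = q (RNeg \<phi>)"
  using rep_q[of \<phi>] by (simp add: L_def q_eq equi_RNeg)

lemma lneg_L [simp]: "LNegC \<in> \<Psi> \<Longrightarrow> \<phi> \<in> fms \<Psi> \<Longrightarrow> lneg L (q \<phi>) = q (LNeg \<phi>)"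
  using rep_q[of \<phi>] by (simp add: L_def q_eq equi_LNeg)

lemma le_L [simp]:
  assumes "\<phi> \<in> fms \<Psi>" "\<psi> \<in> fms \<Psi>"
  shows "le L (q \<phi>) (q \<psi>) \<longleftrightarrow> below \<phi> \<psi>"
  using assms lang below_refl below_Vee2
  by (auto simp: le_def q_eq equi_def Vee_below_iff)

lemma join_semilattice_L: "join_semilattice L"
proof
  fix x y z assume "x \<in> carrier L" "y \<in> carrier L" "z \<in> carrier L"
  then obtain \<phi> \<psi> \<chi> where "\<phi> \<in> fms \<Psi>" "x = q \<phi>" "\<psi> \<in> fms \<Psi>" "y = q \<psi>" "\<chi> \<in> fms \<Psi>" "z = q \<chi>"
    by auto
  then show "vee L (vee L x y) z = vee L x (vee L y z)"
    using lang by (auto simp: q_eq Vee_below_iff intro!: equiI)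
qed (use lang in \<open>auto simp: q_eq Vee_below_iff intro!: equiI\<close>)

lemma pointed_sl_monoid_L: "pointed_sl_monoid L"
proof -
  interpret join_semilattice L by (rule join_semilattice_L)
  show ?thesis
    by unfold_locales
      (use lang in \<open>auto simp: q_eq Fus_assoc One_Fus Fus_One Fus_Vee Vee_Fus\<close>)
qed

lemma lattice_alg_L:
  assumes "WedgeC \<in> \<Psi>"
  shows "lattice_alg L"
proof -
  interpret join_semilattice L by (rule join_semilattice_L)
  show ?thesis
  proof unfold_locales
    fix x y assume "x \<in> carrier L" "y \<in> carrier L"
    then obtain \<phi> \<psi> where mem: "\<phi> \<in> fms \<Psi>" "x = q \<phi>" "\<psi> \<in> fms \<Psi>" "y = q \<psi>"
      by auto
    \<comment> \<open>Absorption mixes the upper-bound property of joins with the lower-bound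
      property of meets, so both inequalities are proved directly.\<close>
    have "equi (Vee \<phi> (Wedge \<phi> \<psi>)) \<phi>" "equi (Wedge \<phi> (Vee \<phi> \<psi>)) \<phi>"
      using mem lang assms unfolding equi_def
      by (simp_all add: Vee_below_iff below_Wedge_iff below_refl Wedge_below1 below_Vee1)
    then show "vee L x (wedge L x y) = x" "wedge L x (vee L x y) = x"
      using mem lang assms by (simp_all add: q_eq)
  qed (use lang assms in \<open>auto simp: q_eq below_Wedge_iff intro!: equiI'\<close>)
qed

lemma structural_L: "structural \<sigma> L"
  using lang Fus_comm below_One Zero_below below_Fus_self
  by (auto simp: structural_def q_eq)

text \<open>\<open>negations\<close> ties the two negations together, so both must be in the
  language as soon as one is; \<open>neg_lang\<close> provides this.\<close>

lemma negations_L: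
  assumes "RNegC \<in> \<Psi> \<or> LNegC \<in> \<Psi>"
  shows "negations L"
proof -
  have "RNegC \<in> \<Psi>" "LNegC \<in> \<Psi>" using assms neg_lang by auto
  then show ?thesis
    using lang by (auto simp: negations_def below_RNeg_iff below_LNeg_iff)
qed

lemma L_class: "L \<in> alg_class \<sigma> \<Psi>"
  by (simp add: alg_class_def M_sl_def pointed_sl_monoid_L structural_L lattice_alg_L negations_L)

lemma ev_L: "\<phi> \<in> fms \<Psi> \<Longrightarrow> ev L (\<lambda>i. q (Var i)) \<phi> = q \<phi>"
  by (induction \<phi>) simp_all

text \<open>In the quotient the equation means 1 \<le> \<phi>, and a 1 on the left of a sequent can
  be added or dropped.\<close>

lemma sat_L_iff:
  assumes "\<phi> \<in> fms \<Psi>"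
  shows "sat L (\<lambda>i. q (Var i)) (Vee One \<phi> \<approx> \<phi>) \<longleftrightarrow> pr ([] \<leadsto> Some \<phi>)"
  using assms lang le_L[of One \<phi>] by (simp add: ev_L le_def One_below_iff)

end

section \<open>Algebraic semantics\<close>

text \<open>The common form of the four cases: the hypotheses on \<open>\<Psi>\<close> are the
  features that the four languages share.\<close>

lemma algebraic_semantics_alg_class:
  assumes inf: "infinite (UNIV :: 'a set)"
    and lang: "VeeC \<in> \<Psi>" "FusC \<in> \<Psi>" "ZeroC \<in> \<Psi>" "OneC \<in> \<Psi>"
    and neg: "RNegC \<in> \<Psi> \<longleftrightarrow> LNegC \<in> \<Psi>"
  shows "algebraic_semantics \<Psi> (eFL \<sigma> \<Psi>) (alg_class \<sigma> \<Psi> :: 'a alg set) (\<lambda>p. Vee One p \<approx> p)"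
  unfolding algebraic_semantics_def
proof (intro allI impI iffI)
  fix \<Sigma> \<phi> assume fms: "\<Sigma> \<subseteq> fms \<Psi>" "\<phi> \<in> fms \<Psi>"
  let ?\<Phi> = "{[] \<leadsto> Some \<psi> | \<psi>. \<psi> \<in> \<Sigma>}"
  {
    assume der: "eFL \<sigma> \<Psi> \<Sigma> \<phi>"
    show "eq_conseq (alg_class \<sigma> \<Psi> :: 'a alg set) ((\<lambda>p. Vee One p \<approx> p) ` \<Sigma>) (Vee One \<phi> \<approx> \<phi>)"
      unfolding eq_conseq_def
    proof (intro ballI allI impI)
      fix A :: "'a alg" and h
      assume "A \<in> alg_class \<sigma> \<Psi>" "range h \<subseteq> carrier A"
        and hyps: "\<forall>e \<in> (\<lambda>p. Vee One p \<approx> p) ` \<Sigma>. sat A h e"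
      then interpret valuation \<sigma> \<Psi> A h by unfold_locales
      have "valid A h ([] \<leadsto> Some \<phi>)"
        using der hyps unfolding eFL_def by (elim FL_sound) (auto simp: le_def)
      then show "sat A h (Vee One \<phi> \<approx> \<phi>)" by (simp add: le_def)
    qed
  next
    assume conseq: "eq_conseq (alg_class \<sigma> \<Psi> :: 'a alg set)
      ((\<lambda>p. Vee One p \<approx> p) ` \<Sigma>) (Vee One \<phi> \<approx> \<phi>)"
    \<comment> \<open>The countermodel depends on \<open>\<Sigma>\<close>: its order is derivability
      from these premises.\<close>
    interpret calculus \<sigma> \<Psi> ?\<Phi> using lang by unfold_locales
    obtain q :: "fm \<Rightarrow> 'a"
      where q: "\<And>\<phi> \<psi>. \<phi> \<in> fms \<Psi> \<Longrightarrow> \<psi> \<in> fms \<Psi> \<Longrightarrow> q \<phi> = q \<psi> \<longleftrightarrow> equi \<phi> \<psi>"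
      using quotient_map[OF inf] by blast
    interpret lindenbaum \<sigma> \<Psi> ?\<Phi> q using q neg by unfold_locales
    \<comment> \<open>Premises are subject to the language restriction as well;
      \<open>\<Sigma> \<subseteq> fms \<Psi>\<close> makes them usable.\<close>
    have "pr ([] \<leadsto> Some \<psi>)" if "\<psi> \<in> \<Sigma>" for \<psi>
      using that fms by (intro FL_base) auto
    then have "\<forall>e \<in> (\<lambda>p. Vee One p \<approx> p) ` \<Sigma>. sat L (\<lambda>i. q (Var i)) e"
      using fms sat_L_iff by blast
    moreover have "range (\<lambda>i. q (Var i)) \<subseteq> carrier L" by auto
    ultimately have "sat L (\<lambda>i. q (Var i)) (Vee One \<phi> \<approx> \<phi>)"
      using conseq L_class unfolding eq_conseq_def by blast
    then show "eFL \<sigma> \<Psi> \<Sigma> \<phi>" using fms sat_L_iff by (simp add: eFL_def)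
  }
qed

theorem theorem30:
  fixes \<sigma> :: "letter set"
  assumes "infinite (UNIV :: 'a set)"
  shows
    "algebraic_semantics {VeeC, FusC, ZeroC, OneC}
       (eFL \<sigma> {VeeC, FusC, ZeroC, OneC})
       (M_sl \<sigma> :: 'a alg set) (\<lambda>p. Vee One p \<approx> p) \<and>
     algebraic_semantics {VeeC, WedgeC, FusC, ZeroC, OneC}
       (eFL \<sigma> {VeeC, WedgeC, FusC, ZeroC, OneC})
       (M_l \<sigma> :: 'a alg set) (\<lambda>p. Vee One p \<approx> p) \<and>
     algebraic_semantics {VeeC, FusC, RNegC, LNegC, ZeroC, OneC}
       (eFL \<sigma> {VeeC, FusC, RNegC, LNegC, ZeroC, OneC})
       (PM_sl \<sigma> :: 'a alg set) (\<lambda>p. Vee One p \<approx> p) \<and>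
     algebraic_semantics {VeeC, WedgeC, FusC, RNegC, LNegC, ZeroC, OneC}
       (eFL \<sigma> {VeeC, WedgeC, FusC, RNegC, LNegC, ZeroC, OneC})
       (PM_l \<sigma> :: 'a alg set) (\<lambda>p. Vee One p \<approx> p)"
proof -
  \<comment> \<open>For a concrete language the conditional clauses of \<open>alg_class\<close> are
    decided by which connectives occur in it.\<close>
  have "(M_sl \<sigma> :: 'a alg set) = alg_class \<sigma> {VeeC, FusC, ZeroC, OneC}"
    "(M_l \<sigma> :: 'a alg set) = alg_class \<sigma> {VeeC, WedgeC, FusC, ZeroC, OneC}"
    "(PM_sl \<sigma> :: 'a alg set) = alg_class \<sigma> {VeeC, FusC, RNegC, LNegC, ZeroC, OneC}"
    "(PM_l \<sigma> :: 'a alg set) = alg_class \<sigma> {VeeC, WedgeC, FusC, RNegC, LNegC, ZeroC, OneC}"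
    by (auto simp: alg_class_def M_l_def PM_sl_def PM_l_def)
  then show ?thesis
    by (simp only:) (intro conjI algebraic_semantics_alg_class assms; simp)
qed

end
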